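(* Let $\mathbf{W}=(w_{i,j})_{0\le i\le p,\,-s\le j\le\ell}$ be a weight matrix. For any feedback filters $h^{i,j}$ satisfying $\|h^{i,j}\|_1<2$ for all $i=0,\dots,p$ and $j=-s,\dots,\ell$, and any initialization with $|v_{\mathbf{n}}|\le1$ for $\mathbf{n}\in\mathbb{Z}^2\setminus\mathbb{N}^2$, the two-index sequence $v$ defined for $\mathbf{n}\in\mathbb{N}^2$ by the recursion $$v_{\mathbf{n}}-\sum_{i,j}w_{i,j}(h^{i,j}*_{\mathbf{d}_{i,j}}v)_{\mathbf{n}}=y_{\mathbf{n}}-q_{\mathbf{n}},\qquad q_{\mathbf{n}}=\mathrm{sign}\Big(\sum_{i,j}w_{i,j}(h^{i,j}*_{\mathbf{d}_{i,j}}v)_{\mathbf{n}}+y_{\mathbf{n}}\Big)$$ is uniformly bounded. Namely, for each real sample sequence $y=\{y_{\mathbf{n}}\}_{\mathbf{n}\in\mathbb{N}^2}$ with $$\sum_{i,j}w_{i,j}\|h^{i,j}\|_1+\|y\|_\infty\le2,$$ the state variable $v$ satisfies the bound $\|v\|_\infty\le1$.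
   Context: $\mathbb{N}=\{0,1,2,\dots\}$. For $\ell,s,p\in\mathbb{N}$, a weight matrix is a family of reals $(w_{i,j})_{0\le i\le p,\,-s\le j\le\ell}$ with $w_{0,j}=0$ for all $j\le0$ and $\sum_{i=0}^p\sum_{j=-s}^\ell w_{i,j}=1$. Directions: $\mathbf{d}_{i,j}=(i,j)\in\mathbb{Z}^2$. A feedback filter is a real sequence $h=\{h_n\}_{n\in\mathbb{Z}}$ supported in $\{1,\dots,L\}$ for some $L\in\mathbb{N}$; $\|h\|_1=\sum_n|h_n|$. Directional convolution: $(h*_{\mathbf{d}}v)_{\mathbf{n}}=\sum_{k=1}^Lh_kv_{\mathbf{n}-k\mathbf{d}}$. Sums over $i,j$ run over $0\le i\le p$, $-s\le j\le\ell$. $\mathrm{sign}(x)=1$ for $x>0$ and $\mathrm{sign}(x)=-1$ for $x\le0$. $\|y\|_\infty=\sup_{\mathbf{n}}|y_{\mathbf{n}}|$, $\|v\|_\infty=\sup_{\mathbf{n}}|v_{\mathbf{n}}|$.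
   Formalization: The stability condition is taken with absolute values |w_{i,j}| in place of w_{i,j}, since with negative weights the condition as written does not imply ‖v‖_∞ ≤ 1; for nonnegative weights the two conditions agree. *)

theory Defs
  imports "HOL-Analysis.Analysis"
begin

definition quadrant :: "(int \<times> int) set" where
  "quadrant = {0..} \<times> {0..}"

(* Entries may be negative.  For nonnegative entries the factor abs (w i j) in the
   stability condition of the main theorem is just w i j.  For signed entries the
   condition with w i j itself is not sufficient: take p = l = 1, s = 0, w_(1,0) = 2,
   w_(0,1) = -1 and the remaining entries 0, let h^(0,1) be the unit mass at 1 and all
   other filters 0, y = 3 on the quadrant and v = -1 off it.  The condition reads
   -1 + 3 <= 2, but v_(m,0) = 3. *)
definition weight_matrix :: "nat \<Rightarrow> nat \<Rightarrow> nat \<Rightarrow> (int \<Rightarrow> int \<Rightarrow> real) \<Rightarrow> bool" where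
  "weight_matrix p s l w \<longleftrightarrow>
     (\<forall>j\<in>{- int s..int l}. j \<le> 0 \<longrightarrow> w 0 j = 0) \<and>
     (\<Sum>i = 0..int p. \<Sum>j = - int s..int l. w i j) = 1"

definition feedback_filter :: "nat \<Rightarrow> (int \<Rightarrow> real) \<Rightarrow> bool" where
  "feedback_filter L h \<longleftrightarrow> (\<forall>n. n \<notin> {1..int L} \<longrightarrow> h n = 0)"

definition l1_norm :: "(int \<Rightarrow> real) \<Rightarrow> real" where
  "l1_norm h = (\<Sum>\<^sub>\<infinity>n. \<bar>h n\<bar>)"

(* Extended-real valued, so that it is infinite for unbounded sequences. *)
definition sup_norm_on :: "(int \<times> int) set \<Rightarrow> (int \<times> int \<Rightarrow> real) \<Rightarrow> ereal" where
  "sup_norm_on A v = (SUP n\<in>A. ereal \<bar>v n\<bar>)"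

definition dir_conv ::
  "nat \<Rightarrow> (int \<Rightarrow> real) \<Rightarrow> int \<times> int \<Rightarrow> (int \<times> int \<Rightarrow> real) \<Rightarrow> int \<times> int \<Rightarrow> real" where
  "dir_conv L h d v n =
     (\<Sum>k = 1..int L. h k * v (fst n - k * fst d, snd n - k * snd d))"

(* The direction with index (i, j) is (i, j) itself. *)
definition feedback ::
  "nat \<Rightarrow> nat \<Rightarrow> nat \<Rightarrow> (int \<Rightarrow> int \<Rightarrow> real) \<Rightarrow> (int \<Rightarrow> int \<Rightarrow> nat) \<Rightarrow> (int \<Rightarrow> int \<Rightarrow> int \<Rightarrow> real)
     \<Rightarrow> (int \<times> int \<Rightarrow> real) \<Rightarrow> int \<times> int \<Rightarrow> real" where
  "feedback p s l w L h v n =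
     (\<Sum>i = 0..int p. \<Sum>j = - int s..int l. w i j * dir_conv (L i j) (h i j) (i, j) v n)"

(* Unlike the library function sgn, the value at 0 is -1. *)
definition sign1 :: "real \<Rightarrow> real" where
  "sign1 x = (if x > 0 then 1 else - 1)"

end

theory Submission
  imports Defs
begin

text \<open>This is the invariant-interval argument for a greedy one-bit quantizer. With
  \<open>u = feedback p s l w L h v n + y n\<close>, the recursion reads
  \<open>v n = u - sign1 u\<close>, and \<open>x - sign1 x\<close> maps [-2, 2] into [-1, 1]
  (\<open>abs_minus_sign1_le\<close>). If all values of \<open>v\<close> that the feedback uses lie
  in [-1, 1], then \<open>abs_feedback_le\<close> and the stability condition give
  \<open>\<bar>u\<bar> \<le> 2\<close>, so \<open>v n\<close> lies in [-1, 1] too. Directions of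
  nonzero weight point back lexicographically, so the bound spreads over the quadrant by
  well-founded induction.\<close>

lemma l1_norm_feedback_filter:
  assumes "feedback_filter L h"
  shows "l1_norm h = (\<Sum>k = 1..int L. \<bar>h k\<bar>)"
proof -
  have "l1_norm h = (\<Sum>\<^sub>\<infinity>k\<in>{1..int L}. \<bar>h k\<bar>)"
    unfolding l1_norm_def
    using assms by (intro infsum_cong_neutral) (auto simp: feedback_filter_def)
  then show ?thesis
    by simp
qed

text \<open>The triangle inequality, with \<open>v\<close> controlled only at the points reached by
  \<open>k \<ge> 1\<close> steps back along \<open>d\<close>, which is the form an induction can
  supply.\<close>

lemma abs_dir_conv_le:
  assumes "feedback_filter L h"
    and "\<And>k. k \<ge> 1 \<Longrightarrow> \<bar>v (fst n - k * fst d, snd n - k * snd d)\<bar> \<le> 1"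
  shows "\<bar>dir_conv L h d v n\<bar> \<le> l1_norm h"
proof -
  have "\<bar>dir_conv L h d v n\<bar>
      \<le> (\<Sum>k = 1..int L. \<bar>h k * v (fst n - k * fst d, snd n - k * snd d)\<bar>)"
    unfolding dir_conv_def by (rule sum_abs)
  also have "\<dots> \<le> (\<Sum>k = 1..int L. \<bar>h k\<bar>)"
    using assms(2) by (intro sum_mono) (auto simp: abs_mult intro!: mult_left_le)
  finally show ?thesis
    by (simp add: l1_norm_feedback_filter[OF assms(1)])
qed

text \<open>The bound on \<open>v\<close> is demanded only where \<open>w i j \<noteq> 0\<close>:
  directions such as (0, 0) point to \<open>n\<close> itself or to later points, about which an
  induction knows nothing, but their terms vanish.\<close>

lemma abs_feedback_le:
  assumes "\<And>i j. i \<in> {0..int p} \<Longrightarrow> j \<in> {- int s..int l} \<Longrightarrow> feedback_filter (L i j) (h i j)"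
    and "\<And>i j k. i \<in> {0..int p} \<Longrightarrow> j \<in> {- int s..int l} \<Longrightarrow> w i j \<noteq> 0 \<Longrightarrow> k \<ge> 1
           \<Longrightarrow> \<bar>v (fst n - k * i, snd n - k * j)\<bar> \<le> 1"
  shows "\<bar>feedback p s l w L h v n\<bar>
           \<le> (\<Sum>i = 0..int p. \<Sum>j = - int s..int l. \<bar>w i j\<bar> * l1_norm (h i j))"
proof -
  have "\<bar>w i j * dir_conv (L i j) (h i j) (i, j) v n\<bar> \<le> \<bar>w i j\<bar> * l1_norm (h i j)"
    if "i \<in> {0..int p}" "j \<in> {- int s..int l}" for i j
  proof (cases "w i j = 0")
    case False
    have "\<bar>dir_conv (L i j) (h i j) (i, j) v n\<bar> \<le> l1_norm (h i j)"
      using that False by (intro abs_dir_conv_le assms(1)) (auto intro!: assms(2))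
    then show ?thesis
      by (simp add: abs_mult mult_left_mono)
  qed simp
  then show ?thesis
    unfolding feedback_def
    by (intro order_trans[OF sum_abs] sum_mono)
qed

text \<open>On (0, 2] the map subtracts 1, and on [-2, 0] it adds 1; both images lie in [-1, 1].
  This is the source of the constant 2 in the stability condition.\<close>

lemma abs_minus_sign1_le:
  assumes "\<bar>x\<bar> \<le> 2"
  shows "\<bar>x - sign1 x\<bar> \<le> 1"
  using assms by (auto simp: sign1_def)

theorem proposition4p1:
  fixes p s l :: nat
    and w :: "int \<Rightarrow> int \<Rightarrow> real"
    and L :: "int \<Rightarrow> int \<Rightarrow> nat"
    and h :: "int \<Rightarrow> int \<Rightarrow> int \<Rightarrow> real"
    and v y q :: "int \<times> int \<Rightarrow> real"
  assumes "weight_matrix p s l w"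
    and "\<And>i j. i \<in> {0..int p} \<Longrightarrow> j \<in> {- int s..int l} \<Longrightarrow> feedback_filter (L i j) (h i j)"
    and "\<And>i j. i \<in> {0..int p} \<Longrightarrow> j \<in> {- int s..int l} \<Longrightarrow> l1_norm (h i j) < 2"
    and "\<And>n. n \<notin> quadrant \<Longrightarrow> \<bar>v n\<bar> \<le> 1"
    and "\<And>n. n \<in> quadrant \<Longrightarrow> v n - feedback p s l w L h v n = y n - q n"
    and "\<And>n. n \<in> quadrant \<Longrightarrow> q n = sign1 (feedback p s l w L h v n + y n)"
    and "ereal (\<Sum>i = 0..int p. \<Sum>j = - int s..int l. \<bar>w i j\<bar> * l1_norm (h i j))
           + sup_norm_on quadrant y \<le> 2"
  shows "bounded (range v) \<and> sup_norm_on UNIV v \<le> 1"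
proof -
  define S where "S = (\<Sum>i = 0..int p. \<Sum>j = - int s..int l. \<bar>w i j\<bar> * l1_norm (h i j))"
  \<comment> \<open>The stability condition as a pointwise inequality between reals, the form used
    at each point of the induction.\<close>
  have y: "S + \<bar>y n\<bar> \<le> 2" if "n \<in> quadrant" for n
  proof -
    have "ereal \<bar>y n\<bar> \<le> sup_norm_on quadrant y"
      unfolding sup_norm_on_def using that by (rule SUP_upper)
    then have "ereal S + ereal \<bar>y n\<bar> \<le> 2"
      using assms(7) unfolding S_def by (meson add_left_mono order_trans)
    then show ?thesis
      by simp
  qed
  \<comment> \<open>A direction \<open>(i, j)\<close> of nonzero weight has \<open>i > 0\<close>, or \<open>i = 0\<close> and \<open>j > 0\<close>. So the
    recursion at a point only uses lexicographically smaller points.\<close>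
  have bound: "\<bar>v n\<bar> \<le> 1" for n
  proof (induction n rule: wf_induct_rule[OF wf_inv_image[OF wf_lex_prod[OF wf_less_than wf_less_than],
          of "\<lambda>n. (nat (fst n), nat (snd n))"]])
    case (1 n)
    show ?case
    proof (cases "n \<in> quadrant")
      case True
      have past: "\<bar>v (fst n - k * i, snd n - k * j)\<bar> \<le> 1"
        if ij: "i \<in> {0..int p}" "j \<in> {- int s..int l}" "w i j \<noteq> 0" and k: "k \<ge> 1" for i j k
      \<comment> \<open>The split matters because \<open>nat\<close> sends negative coordinates to
        0, so a step out of the quadrant need not decrease the measure; there the initialization
        gives the bound. Inside the quadrant \<open>nat\<close> preserves the order.\<close>
      proof (cases "(fst n - k * i, snd n - k * j) \<in> quadrant")
        case inside: True
        have "i > 0 \<or> i = 0 \<and> j > 0"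
          using assms(1) ij by (cases "i = 0") (auto simp: weight_matrix_def not_less[symmetric])
        then have "k * i > 0 \<or> i = 0 \<and> k * j > 0"
          using k by auto
        then show ?thesis
          using inside by (intro 1) (auto simp: quadrant_def)
      qed (rule assms(4))
      have "\<bar>feedback p s l w L h v n\<bar> \<le> S"
        unfolding S_def using assms(2) past by (rule abs_feedback_le)
      then have "\<bar>feedback p s l w L h v n + y n\<bar> \<le> 2"
        using y[OF True] by linarith
      \<comment> \<open>Eliminating \<open>q\<close> exhibits \<open>v n\<close> as the quantization
        error of the argument of \<open>sign1\<close>.\<close>
      moreover have "v n = feedback p s l w L h v n + y n - sign1 (feedback p s l w L h v n + y n)"
        using assms(5,6)[OF True] by linarith
      ultimately show ?thesis
        using abs_minus_sign1_le by metis
    qed (rule assms(4))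
  qed
  then have "bounded (range v)"
    by (auto simp: bounded_iff)
  moreover have "sup_norm_on UNIV v \<le> 1"
    unfolding sup_norm_on_def using bound by (auto intro!: SUP_least)
  ultimately show ?thesis ..
qed

end
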